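(* For every natural number $n \ge 1$ the following identities hold. If $n \equiv 0 \pmod 4$: $$4^{\lfloor n/2\rfloor}\,(\lfloor n/2\rfloor)! = 2\prod_{\lambda=0}^{\lfloor (n-4)/4\rfloor}\left[n^2-(4\lambda)^2\right].$$ If $n \equiv 1 \pmod 4$: $$4^{\lfloor n/2\rfloor}\,(\lfloor n/2\rfloor)! = \prod_{\lambda=1}^{\lfloor (n-1)/4\rfloor}\left[(n+1)^2-(4\lambda-2)^2\right].$$ If $n \equiv 2 \pmod 4$: $$4^{\lfloor n/2\rfloor}\,(\lfloor n/2\rfloor)! = 2n\prod_{\lambda=1}^{\lfloor (n-2)/4\rfloor}\left[n^2-(4\lambda-2)^2\right].$$ If $n \equiv 3 \pmod 4$: $$4^{\lfloor n/2\rfloor}\,(\lfloor n/2\rfloor)! = (n+1)\prod_{\lambda=1}^{\lfloor (n-3)/4\rfloor}\left[(n+1)^2-(4\lambda)^2\right].$$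
   Context: Empty products equal $1$. *)

theory Defs imports Main begin

end

theory Submission imports Defs begin

text \<open>
  Factoring each difference of squares splits the product into an ascending run and a descending
  run of consecutive integers, up to powers of 16. The two runs together form a single factorial.
  Only two products occur: the base of the squares is \<open>4m + 2\<close> when \<open>n\<close> is 1 or 2 modulo 4, and
  \<open>4(m + 1)\<close> when \<open>n\<close> is 3 or 0 modulo 4.
\<close>

text \<open>Bridges the integer index ranges of the theorem to natural ones, where induction and
  factorials are available.\<close>

lemma prod_atLeastAtMost_int_eq_nat:
  "(\<Prod>l = int a..int b. f l) = (\<Prod>l = a..b. f (int l))"
proof -
  have "{int a..int b} = int ` {a..b}"
    by (simp add: image_int_atLeastAtMost)
  then show ?thesis
    by (simp add: prod.reindex)
qed

lemma fact_mult_prod_ascending: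
  "fact a * (\<Prod>l = 1..k. int a + int l) = fact (a + k)"
proof (induction k)
  case (Suc k)
  have "fact a * (\<Prod>l = 1..Suc k. int a + int l)
      = (int a + int (Suc k)) * (fact a * (\<Prod>l = 1..k. int a + int l))"
    by simp
  also have "\<dots> = fact (a + Suc k)"
    unfolding Suc.IH by simp
  finally show ?case .
qed simp

lemma prod_descending_eq_fact:
  "(\<Prod>l = 1..m. int m + 1 - int l) = fact m"
proof -
  have "(\<Prod>l = 1..m. int m + 1 - int l) = (\<Prod>l = 1..m. int l)"
    by (rule prod.reindex_bij_witness[where i = "\<lambda>l. m + 1 - l" and j = "\<lambda>l. m + 1 - l"])
       auto
  then show ?thesis
    by (simp add: fact_prod)
qed

lemma four_power_double: "(4::int) ^ (2 * m) = 16 ^ m"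
  by (simp add: power_mult)

text \<open>Each factor is \<open>(4m + 4 - 4l)(4m + 4l)\<close>. The descending run gives
  \<open>m!\<close>, and the ascending run \<open>m + 1, ..., 2m\<close> continues it without a
  gap.\<close>

lemma prod_diff_squares_2_mod_4:
  "(\<Prod>l = 1..int m. (4 * int m + 2)^2 - (4 * l - 2)^2) = 16 ^ m * fact (2 * m)"
proof -
  have "(\<Prod>l = 1..int m. (4 * int m + 2)^2 - (4 * l - 2)^2)
      = (\<Prod>l = 1..m. (4 * int m + 2)^2 - (4 * int l - 2)^2)"
    using prod_atLeastAtMost_int_eq_nat[of _ 1 m] by simp
  also have "\<dots> = (\<Prod>l = 1..m. 16 * ((int m + 1 - int l) * (int m + int l)))"
    by (rule prod.cong) (simp_all add: algebra_simps power2_eq_square)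
  also have "\<dots> = 16 ^ m * (fact m * (\<Prod>l = 1..m. int m + int l))"
    by (simp only: prod.distrib prod_descending_eq_fact prod_constant card_atLeastAtMost diff_Suc_1)
  also have "\<dots> = 16 ^ m * fact (2 * m)"
    by (simp only: fact_mult_prod_ascending mult_2)
  finally show ?thesis .
qed

text \<open>Here the ascending run starts at \<open>m + 2\<close>, so \<open>m + 1\<close> is
  missing between the two runs; the prefactor \<open>int m + 1\<close> fills this gap.\<close>

lemma prod_diff_squares_0_mod_4:
  "(int m + 1) * (\<Prod>l = 1..int m. (4 * (int m + 1))^2 - (4 * l)^2)
    = 16 ^ m * fact (2 * m + 1)"
proof -
  have "(\<Prod>l = 1..int m. (4 * (int m + 1))^2 - (4 * l)^2)
      = (\<Prod>l = 1..m. (4 * (int m + 1))^2 - (4 * int l)^2)"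
    using prod_atLeastAtMost_int_eq_nat[of _ 1 m] by simp
  also have "\<dots> = (\<Prod>l = 1..m. 16 * ((int m + 1 - int l) * (int (m + 1) + int l)))"
    by (rule prod.cong) (simp_all add: algebra_simps power2_eq_square)
  also have "\<dots> = 16 ^ m * (fact m * (\<Prod>l = 1..m. int (m + 1) + int l))"
    by (simp only: prod.distrib prod_descending_eq_fact prod_constant card_atLeastAtMost diff_Suc_1)
  finally have "(int m + 1) * (\<Prod>l = 1..int m. (4 * (int m + 1))^2 - (4 * l)^2)
      = 16 ^ m * (fact (m + 1) * (\<Prod>l = 1..m. int (m + 1) + int l))"
    by (simp add: algebra_simps)
  also have "fact (m + 1) * (\<Prod>l = 1..m. int (m + 1) + int l) = fact (2 * m + 1)"
    unfolding fact_mult_prod_ascending by (rule arg_cong[where f = fact]) simp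
  finally show ?thesis .
qed

theorem theorem8:
  fixes n :: nat
  assumes "n \<ge> 1"
  shows "(n mod 4 = 0 \<longrightarrow>
      (4::int) ^ (n div 2) * fact (n div 2)
        = 2 * (\<Prod>l = 0..(int n - 4) div 4. ((int n)^2 - (4 * l)^2)))
    \<and> (n mod 4 = 1 \<longrightarrow>
      (4::int) ^ (n div 2) * fact (n div 2)
        = (\<Prod>l = 1..(int n - 1) div 4. ((int n + 1)^2 - (4 * l - 2)^2)))
    \<and> (n mod 4 = 2 \<longrightarrow>
      (4::int) ^ (n div 2) * fact (n div 2)
        = 2 * int n * (\<Prod>l = 1..(int n - 2) div 4. ((int n)^2 - (4 * l - 2)^2)))
    \<and> (n mod 4 = 3 \<longrightarrow>
      (4::int) ^ (n div 2) * fact (n div 2)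
        = (int n + 1) * (\<Prod>l = 1..(int n - 3) div 4. ((int n + 1)^2 - (4 * l)^2)))"
proof (intro conjI impI)
  assume "n mod 4 = 0"
  \<comment> \<open>Positivity of \<open>n\<close> excludes \<open>n = 0\<close>, so the quotient by
    4 can be written as a successor.\<close>
  with assms have "\<exists>m. n = 4 * (m + 1)"
    by presburger
  then obtain m where n: "n = 4 * (m + 1)" ..
  have half: "n div 2 = 2 * m + 2" and bound: "(int n - 4) div 4 = int m"
    using n by simp_all
  let ?P = "\<Prod>l = 1..int m. (4 * (int m + 1))^2 - (4 * l)^2"
  \<comment> \<open>The factor at \<open>l = 0\<close> is \<open>n^2 = 16(m + 1)^2\<close>; one copy
    of \<open>m + 1\<close> is kept as the prefactor of \<open>?P\<close>.\<close>
  have "{0..int m} = insert 0 {1..int m}"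
    by auto
  then have "2 * (\<Prod>l = 0..int m. (int n)^2 - (4 * l)^2)
      = 32 * (int m + 1) * ((int m + 1) * ?P)"
    by (simp add: n power2_eq_square algebra_simps)
  also have "\<dots> = 32 * (int m + 1) * (16 ^ m * fact (2 * m + 1))"
    by (simp only: prod_diff_squares_0_mod_4)
  \<comment> \<open>Split \<open>32(m + 1)\<close> as \<open>4^2 (2m + 2)\<close>: the second factor
    extends the factorial.\<close>
  also have "\<dots> = 4 ^ (2 * m + 2) * fact (2 * m + 2)"
    by (simp add: four_power_double distrib_left distrib_right)
  finally show "(4::int) ^ (n div 2) * fact (n div 2)
      = 2 * (\<Prod>l = 0..(int n - 4) div 4. (int n)^2 - (4 * l)^2)"
    by (simp only: half bound)
next
  assume "n mod 4 = 1"
  then have "\<exists>m. n = 4 * m + 1"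
    by presburger
  then obtain m where n: "n = 4 * m + 1" ..
  have half: "n div 2 = 2 * m" and bound: "(int n - 1) div 4 = int m"
    and base: "int n + 1 = 4 * int m + 2"
    using n by simp_all
  show "(4::int) ^ (n div 2) * fact (n div 2)
      = (\<Prod>l = 1..(int n - 1) div 4. (int n + 1)^2 - (4 * l - 2)^2)"
    unfolding half bound base
    unfolding prod_diff_squares_2_mod_4 four_power_double ..
next
  assume "n mod 4 = 2"
  then have "\<exists>m. n = 4 * m + 2"
    by presburger
  then obtain m where n: "n = 4 * m + 2" ..
  have half: "n div 2 = 2 * m + 1" and bound: "(int n - 2) div 4 = int m"
    and base: "int n = 4 * int m + 2"
    using n by simp_all
  show "(4::int) ^ (n div 2) * fact (n div 2)
      = 2 * int n * (\<Prod>l = 1..(int n - 2) div 4. (int n)^2 - (4 * l - 2)^2)"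
    unfolding half bound
    \<comment> \<open>Rewriting \<open>int n\<close> any earlier would destroy the left-hand side of
      \<open>bound\<close>.\<close>
    unfolding base
    \<comment> \<open>Now \<open>2n = 4(2m + 1)\<close> supplies the odd power of 4 and the last
      factor of \<open>(2m + 1)!\<close>.\<close>
    unfolding prod_diff_squares_2_mod_4 power_add four_power_double
    by (simp add: distrib_left distrib_right)
next
  assume "n mod 4 = 3"
  then have "\<exists>m. n = 4 * m + 3"
    by presburger
  then obtain m where n: "n = 4 * m + 3" ..
  have half: "n div 2 = 2 * m + 1" and bound: "(int n - 3) div 4 = int m"
    and base: "int n + 1 = 4 * (int m + 1)"
    using n by simp_all
  show "(4::int) ^ (n div 2) * fact (n div 2)
      = (int n + 1) * (\<Prod>l = 1..(int n - 3) div 4. (int n + 1)^2 - (4 * l)^2)"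
    unfolding half bound base
    \<comment> \<open>Reassociating \<open>4(m + 1)\<close> frees \<open>m + 1\<close> as the
      required prefactor; the 4 makes up the odd power.\<close>
    unfolding mult.assoc prod_diff_squares_0_mod_4 power_add four_power_double
    by simp
qed

end
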